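(* Let $L>0$, $A_c>0$ and $T_h\ge T_c>0$ be given constants. Let $\kappa\in C^1([T_c,\infty))$ with $\kappa(T)>0$ for all $T\in[T_c,\infty)$, and let $\rho:[T_c,\infty)\to\mathbb{R}$ be locally Lipschitz continuous with $\rho(T)>0$ for all $T\in[T_c,\infty)$ and $\int_{T_c}^\infty \rho(T)\kappa(T)\,dT=\infty$. Then for any $\alpha_0\in\mathbb{R}$ and any $\gamma\ge 0$ there is a unique classical solution $T\in C^2([0,L])$ of the constant-Seebeck thermoelectric equation $$(\kappa(T)T_x)_x+\rho(T)\,J[T]^2=0\quad\text{for }0<x<L,\qquad T(0)=T_h,\quad T(L)=T_c,$$ where $$J[T]:=\frac{V}{R[T]A_c},\qquad R[T]:=\frac{1+\gamma}{A_c}\int_0^L\rho(T(x))\,dx,\qquad V:=\alpha_0(T_h-T_c).$$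
   Context: Subscript $x$ denotes $d/dx$. The equation is a nonlocal (integro-differential) boundary value problem, because the number $J[T]$ depends on the whole function $T$. Since $\kappa,\rho$ are defined on $[T_c,\infty)$, solutions are understood to take values in $[T_c,\infty)$. *)

theory Defs
  imports "HOL-Analysis.Analysis"
begin

text \<open>
  The space \<open>C\<^sup>k(S)\<close>, for \<open>S\<close> an interval with more than one point. Derivatives are taken
  within \<open>S\<close>, so they are one-sided at endpoints belonging to \<open>S\<close>, and they are continuous
  up to these endpoints. Values outside \<open>S\<close> are irrelevant.
\<close>

primrec Ck_on :: "nat \<Rightarrow> real set \<Rightarrow> (real \<Rightarrow> real) \<Rightarrow> bool" where
  "Ck_on 0 S f \<longleftrightarrow> continuous_on S f"
| "Ck_on (Suc k) S f \<longleftrightarrow>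
     (\<exists>f'. (\<forall>x\<in>S. (f has_real_derivative f' x) (at x within S)) \<and> Ck_on k S f')"

definition thermo_V :: "real \<Rightarrow> real \<Rightarrow> real \<Rightarrow> real" where
  "thermo_V \<alpha>\<^sub>0 T\<^sub>h T\<^sub>c = \<alpha>\<^sub>0 * (T\<^sub>h - T\<^sub>c)"

definition thermo_R :: "real \<Rightarrow> real \<Rightarrow> (real \<Rightarrow> real) \<Rightarrow> real \<Rightarrow> (real \<Rightarrow> real) \<Rightarrow> real" where
  "thermo_R L A\<^sub>c \<rho> \<gamma> T = (1 + \<gamma>) / A\<^sub>c * integral {0..L} (\<lambda>x. \<rho> (T x))"

definition thermo_J ::
  "real \<Rightarrow> real \<Rightarrow> real \<Rightarrow> real \<Rightarrow> (real \<Rightarrow> real) \<Rightarrow> real \<Rightarrow> real \<Rightarrow> (real \<Rightarrow> real) \<Rightarrow> real" where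
  "thermo_J L A\<^sub>c T\<^sub>h T\<^sub>c \<rho> \<alpha>\<^sub>0 \<gamma> T =
     thermo_V \<alpha>\<^sub>0 T\<^sub>h T\<^sub>c / (thermo_R L A\<^sub>c \<rho> \<gamma> T * A\<^sub>c)"

text \<open>
  Classical solutions on \<open>[0,L]\<close>. As \<open>\<kappa>\<close> and \<open>\<rho>\<close> are only meaningful on \<open>[T\<^sub>c,\<infinity>)\<close>, taking values
  there is part of being a solution. The number \<open>q\<close> is \<open>(\<kappa>(T) T\<^sub>x)\<^sub>x\<close> at \<open>x\<close>; quantifying over it
  makes the existence of this derivative part of the equation.
\<close>

definition thermo_solution ::
  "real \<Rightarrow> real \<Rightarrow> real \<Rightarrow> real \<Rightarrow> (real \<Rightarrow> real) \<Rightarrow> (real \<Rightarrow> real) \<Rightarrow> real \<Rightarrow> real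
     \<Rightarrow> (real \<Rightarrow> real) \<Rightarrow> bool" where
  "thermo_solution L A\<^sub>c T\<^sub>h T\<^sub>c \<kappa> \<rho> \<alpha>\<^sub>0 \<gamma> T \<longleftrightarrow>
     Ck_on 2 {0..L} T \<and>
     (\<forall>x\<in>{0..L}. T x \<ge> T\<^sub>c) \<and>
     (\<forall>x\<in>{0<..<L}. \<exists>q.
        ((\<lambda>y. \<kappa> (T y) * deriv T y) has_real_derivative q) (at x) \<and>
        q + \<rho> (T x) * (thermo_J L A\<^sub>c T\<^sub>h T\<^sub>c \<rho> \<alpha>\<^sub>0 \<gamma> T)\<^sup>2 = 0) \<and>
     T 0 = T\<^sub>h \<and> T L = T\<^sub>c"

end

theory Submission
  imports Defs
begin

text \<open>
  The number \<open>J[T]\<close> turns out to be determined by the data alone, and the solution then comes out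
  by quadratures. Put \<open>M = \<bar>V\<bar> / (1 + \<gamma>)\<close>, so that \<open>\<bar>J\<bar> \<integral>\<rho>(T) = M\<close>.

  Suppose \<open>V \<noteq> 0\<close>, write \<open>j = \<bar>J[T]\<bar>\<close>, and divide the heat flux by \<open>j\<close>: with
  \<open>v = \<kappa>(T) T\<^sub>x / j\<close> the equation becomes the system \<open>T\<^sub>x = j v / \<kappa>(T)\<close>,
  \<open>v\<^sub>x = - j \<rho>(T)\<close>. Two observations solve it.

  \<^item> The parameter \<open>j\<close> only sets the speed along the orbits of the system. The orbits are the level sets
    of \<open>v\<^sup>2 / 2 + P(T)\<close>, where \<open>P\<close> is an antiderivative of \<open>\<rho> \<kappa>\<close>. The definition of \<open>J\<close> says
    exactly that \<open>v(0) - v(L) = M\<close>, while the invariant gives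
    \<open>v(0)\<^sup>2 - v(L)\<^sup>2 = - 2 (P(T\<^sub>h) - P(T\<^sub>c))\<close>. Dividing, one gets \<open>v(0) + v(L)\<close>, hence both end values
    and the level \<open>C\<close>. So \<open>T = G(v)\<close> with the explicit function \<open>G(v) = P\<^sup>-\<^sup>1(C - v\<^sup>2 / 2)\<close>. Here the
    divergence of \<open>\<integral>\<rho> \<kappa>\<close> is what makes \<open>P\<^sup>-\<^sup>1\<close> defined at the highest temperature reached.

  \<^item> Now \<open>v\<^sub>x = - j \<rho>(G(v))\<close> separates. If \<open>H\<close> is an antiderivative of \<open>1 / \<rho>(G)\<close>, then
    \<open>H(v(x)) = H(v(0)) - j x\<close>. At \<open>x = L\<close> this gives \<open>j = (H(v(0)) - H(v(L))) / L\<close>, a number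
    depending only on the data; and then it gives \<open>v\<close>, and \<open>T = G(v)\<close>.

  These formulas determine every solution (\<open>coupled_system_unique\<close>), and read backwards they
  define one (\<open>coupled_system_exists\<close>); \<open>solution_coupled_system\<close> and \<open>solution_of_coupled_system\<close>
  translate between the system and the thermoelectric equation.

  If \<open>V = 0\<close>, then \<open>J[T] = 0\<close> for every \<open>T\<close>, the heat flux is constant, and an antiderivative \<open>K\<close> of
  \<open>\<kappa>\<close> turns the problem into a linear one: \<open>K(T(x))\<close> is affine in \<open>x\<close>
  (\<open>conduction_exists\<close>, \<open>conduction_unique\<close>).

  To avoid one-sided derivatives at \<open>T\<^sub>c\<close>, a value that the solution attains, \<open>\<kappa>\<close> and \<open>\<rho>\<close> are extended
  to the left of \<open>T\<^sub>c\<close> by constants. All antiderivatives then live on the whole real line.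
\<close>

section \<open>Antiderivatives of positive functions and their inverses\<close>

text \<open>
  Even if \<open>F\<close> is bounded its range is open, so that a two-sided derivative of the inverse makes sense
  at each of its points.
\<close>

lemma positive_derivative_inverse:
  fixes F f :: "real \<Rightarrow> real"
  assumes F: "\<And>x. (F has_real_derivative f x) (at x)" and pos: "\<And>x. f x > 0"
  shows "strict_mono F" and "continuous_on UNIV F" and "inv F (F x) = x"
    and "(inv F has_real_derivative inverse (f x)) (at (F x))"
proof -
  show mono: "strict_mono F"
    using F pos by (intro strict_monoI) (metis DERIV_pos_imp_increasing)
  show cont: "continuous_on UNIV F"
    using F by (meson DERIV_isCont continuous_at_imp_continuous_on)
  have inv: "inv F (F x) = x" for x
    using mono by (simp add: strict_mono_on_imp_inj_on inv_f_f)
  then show "inv F (F x) = x" .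
  show "(inv F has_real_derivative inverse (f x)) (at (F x))"
    unfolding has_field_derivative_def
    by (rule has_derivative_inverse_strong[of UNIV x F "inv F" "(*) (f x)"])
      (use F[of x] pos[of x] cont inv in \<open>auto simp: has_field_derivative_def o_def\<close>)
qed

lemma antiderivative_exists:
  fixes f :: "real \<Rightarrow> real"
  assumes "continuous_on UNIV f"
  obtains F where "\<And>x. (F has_real_derivative f x) (at x)"
proof -
  have "isCont f x" for x
    using assms by (simp add: continuous_on_eq_continuous_at)
  then have "\<exists>F. \<forall>x::real. - \<infinity> < ereal x \<longrightarrow> ereal x < \<infinity> \<longrightarrow> (F has_vector_derivative f x) (at x)"
    by (intro einterval_antiderivative) auto
  then show thesis
    using that by (auto simp: has_real_derivative_iff_has_vector_derivative)
qed

lemma strict_mono_intermediate_value: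
  fixes F :: "real \<Rightarrow> real"
  assumes "strict_mono F" and "continuous_on UNIV F" and "F a \<le> y" and "y \<le> F b"
  obtains t where "F t = y" "a \<le> t" "t \<le> b"
proof -
  have "a \<le> b"
    using assms strict_mono_less_eq[of F a b] by linarith
  then show thesis
    using IVT'[of F a y b] assms continuous_on_subset that by (metis subset_UNIV)
qed

text \<open>
  To the left of \<open>a\<close> the function \<open>F\<close> is affine with positive slope, so it is unbounded below;
  divergence of the integral makes it unbounded above.
\<close>

lemma surj_antiderivative:
  fixes f F :: "real \<Rightarrow> real"
  assumes F: "\<And>t. (F has_real_derivative f t) (at t)" and pos: "\<And>t. f t > 0"
    and const: "\<And>t. t \<le> a \<Longrightarrow> f t = f a"
    and diverges: "filterlim (\<lambda>b. integral {a..b} f) at_top at_top"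
  shows "surj F"
proof -
  have upper: "\<exists>b. y \<le> F b" for y
  proof -
    have "\<forall>\<^sub>F b in at_top. y - F a \<le> integral {a..b} f \<and> a \<le> b"
      using diverges eventually_ge_at_top[of a] unfolding filterlim_at_top
      by (intro eventually_conj) auto
    then obtain b where b: "y - F a \<le> integral {a..b} f" "a \<le> b"
      by (auto simp: eventually_at_top_linorder)
    have "(f has_integral F b - F a) {a..b}"
      using F b(2)
      by (intro fundamental_theorem_of_calculus)
        (auto simp: has_real_derivative_iff_has_vector_derivative[symmetric]
           intro: has_field_derivative_at_within)
    then show ?thesis
      using b(1) by (auto dest: integral_unique intro!: exI[of _ b])
  qed
  have lower: "\<exists>t. F t \<le> y" for y
  proof -
    define t where "t = a - (1 + \<bar>F a - y\<bar> / f a)"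
    \<comment> \<open>The additional 1 keeps \<open>t\<close> strictly below \<open>a\<close>, as the mean value theorem requires.\<close>
    have "\<bar>F a - y\<bar> / f a \<ge> 0"
      using pos[of a] by simp
    then have "t < a"
      unfolding t_def by linarith
    then obtain z where "z < a" "F a - F t = (a - t) * f z"
      using MVT2[of t a F] F by metis
    then have "F a - F t = (a - t) * f a"
      using const[of z] by simp
    also have "\<dots> = f a + \<bar>F a - y\<bar>"
      unfolding t_def using pos[of a] by (simp add: field_simps)
    finally show ?thesis
      using pos[of a] by (intro exI[of _ t]) linarith
  qed
  show ?thesis
    using strict_mono_intermediate_value[OF positive_derivative_inverse(1,2)[OF F pos]] upper lower
    unfolding surj_def by metis
qed

section \<open>The coupled system of temperature and rescaled heat flux\<close>

text \<open>
  The two quadratures. On the level \<open>C\<close> of \<open>v\<^sup>2 / 2 + P(T)\<close> the temperature is the function \<open>G\<close> of \<open>v\<close>,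
  and \<open>H\<close> is the clock along this level: since \<open>v\<close> moves with velocity \<open>- j r(G(v))\<close>, the value
  \<open>H(v)\<close> decreases at the constant rate \<open>j\<close>. The map \<open>K\<close> reads \<open>v\<close> off the clock. Because \<open>P\<close> is
  onto, \<open>G\<close> and the clock are defined for every real \<open>v\<close>.
\<close>

lemma phase_clock:
  fixes r k P :: "real \<Rightarrow> real" and C :: real
  assumes contr: "continuous_on UNIV r" and posr: "\<And>t. r t > 0"
    and posk: "\<And>t. k t > 0"
    and P: "\<And>t. (P has_real_derivative r t * k t) (at t)" and surj: "surj P"
  obtains G H K where "\<And>u. P (G u) = C - u\<^sup>2 / 2" "\<And>t u. P t = C - u\<^sup>2 / 2 \<Longrightarrow> t = G u"
    "\<And>u. (G has_real_derivative - u / (r (G u) * k (G u))) (at u)"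
    "strict_mono H" "\<And>u. (H has_real_derivative inverse (r (G u))) (at u)"
    "\<And>u. K (H u) = u" "\<And>u. (K has_real_derivative r (G u)) (at (H u))"
proof -
  have rk: "r t * k t > 0" for t
    using posr posk by simp
  note invP = positive_derivative_inverse(3)[OF P rk]
  note dinvP = positive_derivative_inverse(4)[OF P rk]
  define G where "G u = inv P (C - u\<^sup>2 / 2)" for u
  have PG: "P (G u) = C - u\<^sup>2 / 2" for u
    unfolding G_def using surj by (simp add: surj_f_inv_f)
  have uniq: "t = G u" if "P t = C - u\<^sup>2 / 2" for t u
    unfolding G_def that[symmetric] invP ..
  have dG: "(G has_real_derivative - u / (r (G u) * k (G u))) (at u)" for u
  proof -
    have "((\<lambda>u. C - u\<^sup>2 / 2) has_real_derivative - u) (at u)"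
      by (auto intro!: derivative_eq_intros)
    moreover have "(inv P has_real_derivative inverse (r (G u) * k (G u))) (at (C - u\<^sup>2 / 2))"
      using dinvP[of "G u"] by (simp add: PG)
    ultimately have "((\<lambda>u. inv P (C - u\<^sup>2 / 2)) has_real_derivative
        inverse (r (G u) * k (G u)) * - u) (at u)"
      by (rule DERIV_chain2[rotated])
    then show ?thesis
      unfolding G_def by (simp add: field_simps)
  qed
  have "continuous_on UNIV G"
    using dG by (meson DERIV_isCont continuous_at_imp_continuous_on)
  then have "continuous_on UNIV (\<lambda>u. r (G u))"
    using contr by (metis continuous_on_compose2 subset_UNIV)
  then have "continuous_on UNIV (\<lambda>u. inverse (r (G u)))"
    using posr by (intro continuous_on_inverse) (auto simp: less_imp_neq[THEN not_sym])
  then obtain H where dH: "\<And>u. (H has_real_derivative inverse (r (G u))) (at u)"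
    by (rule antiderivative_exists) blast
  have "inverse (r (G u)) > 0" for u
    using posr by simp
  note invH = positive_derivative_inverse[OF dH this]
  have "(inv H has_real_derivative r (G u)) (at (H u))" for u
    using invH(4)[of u] by simp
  then show thesis
    using PG uniq dG invH(1) dH invH(3) by (rule that[rotated -1])
qed

text \<open>
  Here \<open>v\<close> is the rescaled flux \<open>k(T) T\<^sub>x / j\<close>. The condition \<open>v 0 - v L = M\<close> says that
  \<open>j \<integral>r(T) = M\<close>; it replaces the nonlocal coefficient.
\<close>

definition coupled_solution ::
  "(real \<Rightarrow> real) \<Rightarrow> (real \<Rightarrow> real) \<Rightarrow> real \<Rightarrow> real \<Rightarrow> real \<Rightarrow> real
     \<Rightarrow> (real \<Rightarrow> real) \<Rightarrow> (real \<Rightarrow> real) \<Rightarrow> real \<Rightarrow> bool" where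
  "coupled_solution r k L a b M T v j \<longleftrightarrow>
     continuous_on {0..L} T \<and> continuous_on {0..L} v \<and>
     T 0 = a \<and> T L = b \<and> v 0 - v L = M \<and>
     (\<forall>x\<in>{0<..<L}. (T has_real_derivative j * v x / k (T x)) (at x) \<and>
        (v has_real_derivative - j * r (T x)) (at x))"

text \<open>
  The end values \<open>v0\<close> and \<open>vL\<close> below solve \<open>v0 - vL = M\<close> and \<open>v0\<^sup>2 - vL\<^sup>2 = - 2 D\<close>; they fix the
  level \<open>C\<close>, and \<open>j\<close> is chosen so that the clock runs from \<open>H v0\<close> to \<open>H vL\<close> in the length \<open>L\<close>.
  The temperature stays above \<open>b\<close> because \<open>\<bar>v\<bar>\<close> is largest at \<open>x = L\<close>, where \<open>T = b\<close>. The equations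
  hold at the end points too, in two-sided form, as \<open>T\<close> and \<open>v\<close> are defined beyond \<open>[0,L]\<close>.
\<close>

lemma coupled_system_exists:
  fixes r k P :: "real \<Rightarrow> real" and L M a b :: real
  assumes contr: "continuous_on UNIV r" and posr: "\<And>t. r t > 0"
    and posk: "\<And>t. k t > 0"
    and P: "\<And>t. (P has_real_derivative r t * k t) (at t)" and surj: "surj P"
    and L: "L > 0" and M: "M > 0" and ab: "b \<le> a"
  obtains T v j where "j > 0" "T 0 = a" "T L = b" "v 0 - v L = M"
    "\<And>x. x \<in> {0..L} \<Longrightarrow> b \<le> T x"
    "\<And>x. x \<in> {0..L} \<Longrightarrow> (T has_real_derivative j * v x / k (T x)) (at x)"
    "\<And>x. x \<in> {0..L} \<Longrightarrow> (v has_real_derivative - j * r (T x)) (at x)"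
proof -
  have "r t * k t > 0" for t
    using posr posk by simp
  then have monoP: "strict_mono P"
    by (rule positive_derivative_inverse(1)[OF P])
  define D where "D = P a - P b"
  have D: "D \<ge> 0"
    unfolding D_def using ab strict_mono_less_eq[OF monoP] by simp
  define v0 vL where "v0 = M / 2 - D / M" and "vL = - M / 2 - D / M"
  define C where "C = P b + vL\<^sup>2 / 2"
  have less: "vL < v0" and diff: "v0 - vL = M"
    unfolding v0_def vL_def using M by auto
  have "v0\<^sup>2 - vL\<^sup>2 = - 2 * D"
    unfolding v0_def vL_def using M by (simp add: power2_eq_square field_simps)
  then have Ca: "P a = C - v0\<^sup>2 / 2"
    unfolding C_def D_def by simp
  obtain G H K where PG: "\<And>u. P (G u) = C - u\<^sup>2 / 2"
    and uniq: "\<And>t u. P t = C - u\<^sup>2 / 2 \<Longrightarrow> t = G u"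
    and dG: "\<And>u. (G has_real_derivative - u / (r (G u) * k (G u))) (at u)"
    and monoH: "strict_mono H" and dH: "\<And>u. (H has_real_derivative inverse (r (G u))) (at u)"
    and KH: "\<And>u. K (H u) = u" and dK: "\<And>u. (K has_real_derivative r (G u)) (at (H u))"
    using phase_clock[OF contr posr posk P surj] by blast
  have contH: "continuous_on UNIV H"
    using dH by (meson DERIV_isCont continuous_at_imp_continuous_on)
  define j where "j = (H v0 - H vL) / L"
  have j: "j > 0"
    unfolding j_def using L less strict_mono_less[OF monoH] by simp
  have jL: "j * L = H v0 - H vL"
    unfolding j_def using L by simp
  define v where "v x = K (H v0 - j * x)" for x
  define T where "T x = G (v x)" for x
  have vx: "H (v x) = H v0 - j * x \<and> vL \<le> v x \<and> v x \<le> v0" if x: "x \<in> {0..L}" for x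
  proof -
    have "j * x \<le> j * L" "0 \<le> j * x"
      using x j by auto
    then obtain u where "H u = H v0 - j * x" "vL \<le> u" "u \<le> v0"
      using strict_mono_intermediate_value[OF monoH contH, of vL "H v0 - j * x" v0] jL by auto
    then show ?thesis
      unfolding v_def using KH by metis
  qed
  have v0: "v 0 = v0" and vL: "v L = vL"
    unfolding v_def jL by (simp_all add: KH)
  have dv: "(v has_real_derivative - j * r (T x)) (at x)" if "x \<in> {0..L}" for x
  proof -
    have "(K has_real_derivative r (T x)) (at (H v0 - j * x))"
      using dK[of "v x"] vx[OF that] by (simp add: T_def)
    moreover have "((\<lambda>x. H v0 - j * x) has_real_derivative - j) (at x)"
      by (auto intro!: derivative_eq_intros)
    ultimately show ?thesis
      unfolding v_def by (metis DERIV_chain2 mult.commute)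
  qed
  have dT: "(T has_real_derivative j * v x / k (T x)) (at x)" if "x \<in> {0..L}" for x
  proof -
    have "(T has_real_derivative - v x / (r (T x) * k (T x)) * (- j * r (T x))) (at x)"
      unfolding T_def by (rule DERIV_chain2[OF dG dv[OF that, unfolded T_def]])
    then show ?thesis
      using posr[of "T x"] by (simp add: field_simps)
  qed
  have Tb: "b \<le> T x" if "x \<in> {0..L}" for x
  proof -
    \<comment> \<open>This is \<open>v0 + vL = - 2 D / M \<le> 0\<close>.\<close>
    have "v0 \<le> - vL"
      unfolding v0_def vL_def using D M by (simp add: divide_nonneg_pos)
    then have "\<bar>v x\<bar> \<le> \<bar>vL\<bar>"
      using vx[OF that] by auto
    then have "(v x)\<^sup>2 \<le> vL\<^sup>2"
      by (simp add: abs_le_square_iff)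
    then have "P b \<le> P (T x)"
      unfolding T_def PG C_def by simp
    then show ?thesis
      using strict_mono_less_eq[OF monoP] by simp
  qed
  show thesis
  proof (rule that[of j T v])
    show "T 0 = a" "T L = b"
      unfolding T_def v0 vL using uniq Ca uniq[of b vL] C_def by auto
  qed (use j v0 vL diff dv dT Tb in auto)
qed

text \<open>
  Every solution satisfies the formulas \<open>T = G(v)\<close> and \<open>H(v) = H v0 - j x\<close> with the same \<open>G\<close>, \<open>H\<close>
  and \<open>v0\<close>, since the level and both end values of \<open>v\<close> are forced. In particular two solutions share
  the same \<open>j\<close>, although \<open>j\<close> was not prescribed.
\<close>

lemma coupled_system_unique:
  fixes r k P :: "real \<Rightarrow> real" and L M a b :: real
  assumes contr: "continuous_on UNIV r" and posr: "\<And>t. r t > 0"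
    and posk: "\<And>t. k t > 0"
    and P: "\<And>t. (P has_real_derivative r t * k t) (at t)" and surj: "surj P"
    and L: "L > 0" and M: "M > 0"
    and sol: "coupled_solution r k L a b M T\<^sub>1 v\<^sub>1 j\<^sub>1" "coupled_solution r k L a b M T\<^sub>2 v\<^sub>2 j\<^sub>2"
    and x: "x \<in> {0..L}"
  shows "T\<^sub>1 x = T\<^sub>2 x"
proof -
  define D where "D = P a - P b"
  define v0 vL where "v0 = M / 2 - D / M" and "vL = - M / 2 - D / M"
  define C where "C = P b + vL\<^sup>2 / 2"
  have contP: "continuous_on UNIV P"
    using P by (meson DERIV_isCont continuous_at_imp_continuous_on)
  obtain G H K where "\<And>u. P (G u) = C - u\<^sup>2 / 2"
    and uniq: "\<And>t u. P t = C - u\<^sup>2 / 2 \<Longrightarrow> t = G u"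
    and "\<And>u. (G has_real_derivative - u / (r (G u) * k (G u))) (at u)"
    and "strict_mono H" and dH: "\<And>u. (H has_real_derivative inverse (r (G u))) (at u)"
    and KH: "\<And>u. K (H u) = u" and "\<And>u. (K has_real_derivative r (G u)) (at (H u))"
    using phase_clock[OF contr posr posk P surj] by blast
  have contH: "continuous_on UNIV H"
    using dH by (meson DERIV_isCont continuous_at_imp_continuous_on)
  have invariants: "j * L = H v0 - H vL \<and> (\<forall>x\<in>{0..L}. T x = G (v x) \<and> H (v x) = H v0 - j * x)"
    if "coupled_solution r k L a b M T v j" for T v j
  proof -
    have bc: "T 0 = a" "T L = b" "v 0 - v L = M"
      and contT: "continuous_on {0..L} T" and contv: "continuous_on {0..L} v"
      and dT: "\<And>x. x \<in> {0<..<L} \<Longrightarrow> (T has_real_derivative j * v x / k (T x)) (at x)"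
      and dv: "\<And>x. x \<in> {0<..<L} \<Longrightarrow> (v has_real_derivative - j * r (T x)) (at x)"
      using that unfolding coupled_solution_def by auto
    have energy: "P (T x) + (v x)\<^sup>2 / 2 = P a + (v 0)\<^sup>2 / 2" if "x \<in> {0..L}" for x
    proof -
      have "continuous_on {0..L} (\<lambda>x. P (T x) + (v x)\<^sup>2 / 2)"
        using contT contv by (auto intro!: continuous_intros continuous_on_compose2[OF contP])
      moreover have "((\<lambda>x. P (T x) + (v x)\<^sup>2 / 2) has_real_derivative 0) (at y)"
        if "0 < y" "y < L" for y
      proof -
        have y: "y \<in> {0<..<L}" using that by simp
        show ?thesis
          using posk[of "T y"]
          by (auto intro!: derivative_eq_intros DERIV_chain2[OF P] dT[OF y] dv[OF y] simp: field_simps)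
      qed
      ultimately have "P (T x) + (v x)\<^sup>2 / 2 = P (T 0) + (v 0)\<^sup>2 / 2"
        using that by (intro DERIV_isconst2[OF L]) auto
      then show ?thesis
        by (simp add: bc)
    qed
    have "(v 0 - v L) * (v 0 + v L) = - 2 * D"
      using energy[of L] L by (simp add: D_def bc(1,2) power2_eq_square field_simps)
    then have "v 0 + v L = - 2 * D / M"
      unfolding bc using M by (simp add: field_simps)
    then have ends: "v 0 = v0" "v L = vL"
      unfolding v0_def vL_def using bc(3) by (simp_all add: field_simps)
    have TG: "T x = G (v x)" if "x \<in> {0..L}" for x
      using energy[OF that] energy[of L] L
      by (intro uniq) (simp add: ends bc C_def)
    have clock: "H (v x) + j * x = H v0" if "x \<in> {0..L}" for x
    proof -
      have "continuous_on {0..L} (\<lambda>x. H (v x) + j * x)"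
        using contv by (auto intro!: continuous_intros continuous_on_compose2[OF contH])
      moreover have "((\<lambda>x. H (v x) + j * x) has_real_derivative 0) (at y)"
        if "0 < y" "y < L" for y
      proof -
        have y: "y \<in> {0<..<L}" using that by simp
        show ?thesis
          using posr[of "T y"] TG[of y] that
          by (auto intro!: derivative_eq_intros DERIV_chain2[OF dH] dv[OF y] simp: field_simps)
      qed
      ultimately have "H (v x) + j * x = H (v 0) + j * 0"
        using that by (intro DERIV_isconst2[OF L]) auto
      then show ?thesis
        by (simp add: ends)
    qed
    have "j * L = H v0 - H vL"
      using clock[of L] L by (simp add: ends)
    moreover have "H (v x) = H v0 - j * x" if "x \<in> {0..L}" for x
      using clock[OF that] by simp
    ultimately show ?thesis
      using TG by blast
  qed
  have "j\<^sub>1 * L = j\<^sub>2 * L"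
    using invariants[OF sol(1)] invariants[OF sol(2)] by simp
  then have "j\<^sub>1 = j\<^sub>2"
    using L by simp
  then have "H (v\<^sub>1 x) = H (v\<^sub>2 x)"
    using invariants[OF sol(1)] invariants[OF sol(2)] x by simp
  then have "v\<^sub>1 x = v\<^sub>2 x"
    by (metis KH)
  then show ?thesis
    using invariants[OF sol(1)] invariants[OF sol(2)] x by simp
qed

section \<open>Heat conduction without sources\<close>

definition conduction_solution ::
  "(real \<Rightarrow> real) \<Rightarrow> real \<Rightarrow> real \<Rightarrow> real \<Rightarrow> (real \<Rightarrow> real) \<Rightarrow> real \<Rightarrow> bool" where
  "conduction_solution k L a b T c \<longleftrightarrow>
     continuous_on {0..L} T \<and> T 0 = a \<and> T L = b \<and>
     (\<forall>x\<in>{0<..<L}. (T has_real_derivative c / k (T x)) (at x))"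

text \<open>
  The Kirchhoff transform: if \<open>K\<close> is an antiderivative of \<open>k\<close>, then \<open>K(T(x))\<close> has derivative \<open>c\<close>,
  so it is the affine function from \<open>K a\<close> to \<open>K b\<close>. Its values lie between these two, hence in the
  range of \<open>K\<close>, even if \<open>K\<close> is bounded.
\<close>

lemma conduction_exists:
  fixes k :: "real \<Rightarrow> real" and L a b :: real
  assumes contk: "continuous_on UNIV k" and posk: "\<And>t. k t > 0" and L: "L > 0" and ab: "b \<le> a"
  obtains T c where "T 0 = a" "T L = b" "\<And>x. x \<in> {0..L} \<Longrightarrow> b \<le> T x"
    "\<And>x. x \<in> {0..L} \<Longrightarrow> (T has_real_derivative c / k (T x)) (at x)"
proof -
  obtain K where dK: "\<And>t. (K has_real_derivative k t) (at t)"
    using antiderivative_exists[OF contk] by blast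
  note K = positive_derivative_inverse[OF dK posk]
  define c where "c = (K b - K a) / L"
  have cL: "c * L = K b - K a"
    unfolding c_def using L by simp
  define T where "T x = inv K (K a + c * x)" for x
  have Kba: "K b \<le> K a"
    using ab strict_mono_less_eq[OF K(1)] by simp
  then have c: "c \<le> 0"
    unfolding c_def using L by (simp add: divide_nonpos_pos)
  have Tx: "K (T x) = K a + c * x \<and> b \<le> T x" if "x \<in> {0..L}" for x
  proof -
    have "c * L \<le> c * x" "c * x \<le> 0"
      using that c by (auto simp: mult_left_mono_neg mult_nonpos_nonneg)
    then obtain t where "K t = K a + c * x" "b \<le> t"
      using strict_mono_intermediate_value[OF K(1,2), of b "K a + c * x" a] cL by auto
    then show ?thesis
      unfolding T_def using K(3) by metis
  qed
  have "(T has_real_derivative c / k (T x)) (at x)" if "x \<in> {0..L}" for x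
  proof -
    have "(inv K has_real_derivative inverse (k (T x))) (at (K a + c * x))"
      using K(4)[of "T x"] Tx[OF that] by simp
    moreover have "((\<lambda>x. K a + c * x) has_real_derivative c) (at x)"
      by (auto intro!: derivative_eq_intros)
    ultimately show ?thesis
      unfolding T_def by (metis DERIV_chain2 mult.commute divide_inverse)
  qed
  then show thesis
    using that[of T c] Tx K(3) cL by (simp add: T_def)
qed

lemma conduction_unique:
  fixes k :: "real \<Rightarrow> real" and L a b :: real
  assumes contk: "continuous_on UNIV k" and posk: "\<And>t. k t > 0" and L: "L > 0"
    and sol: "conduction_solution k L a b T\<^sub>1 c\<^sub>1" "conduction_solution k L a b T\<^sub>2 c\<^sub>2"
    and x: "x \<in> {0..L}"
  shows "T\<^sub>1 x = T\<^sub>2 x"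
proof -
  obtain K where dK: "\<And>t. (K has_real_derivative k t) (at t)"
    using antiderivative_exists[OF contk] by blast
  note K = positive_derivative_inverse[OF dK posk]
  have linear: "c * L = K b - K a \<and> (\<forall>x\<in>{0..L}. K (T x) = K a + c * x)"
    if "conduction_solution k L a b T c" for T c
  proof -
    have bc: "T 0 = a" "T L = b" and contT: "continuous_on {0..L} T"
      and dT: "\<And>x. x \<in> {0<..<L} \<Longrightarrow> (T has_real_derivative c / k (T x)) (at x)"
      using that unfolding conduction_solution_def by auto
    have const: "K (T x) - c * x = K (T 0) - c * 0" if "x \<in> {0..L}" for x
    proof (rule DERIV_isconst2[OF L])
      show "continuous_on {0..L} (\<lambda>x. K (T x) - c * x)"
        using contT by (auto intro!: continuous_intros continuous_on_compose2[OF K(2)])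
      show "((\<lambda>x. K (T x) - c * x) has_real_derivative 0) (at y)" if "0 < y" "y < L" for y
      proof -
        have "((\<lambda>x. K (T x)) has_real_derivative k (T y) * (c / k (T y))) (at y)"
          using that by (intro DERIV_chain2[OF dK] dT) simp
        then show ?thesis
          using posk[of "T y"] by (auto intro!: derivative_eq_intros)
      qed
    qed (use that in auto)
    have "K (T x) = K a + c * x" if "x \<in> {0..L}" for x
      using const[OF that] bc by simp
    moreover from this[of L] have "c * L = K b - K a"
      using bc L by simp
    ultimately show ?thesis
      by blast
  qed
  have "c\<^sub>1 * L = c\<^sub>2 * L"
    using linear[OF sol(1)] linear[OF sol(2)] by simp
  then have "c\<^sub>1 = c\<^sub>2"
    using L by simp
  then have "K (T\<^sub>1 x) = K (T\<^sub>2 x)"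
    using linear[OF sol(1)] linear[OF sol(2)] x by simp
  then show ?thesis
    by (metis K(3))
qed

section \<open>The thermoelectric equation as a first-order system\<close>

locale thermo_problem =
  fixes L A\<^sub>c T\<^sub>h T\<^sub>c \<alpha>\<^sub>0 \<gamma> :: real and \<kappa> \<rho> :: "real \<Rightarrow> real"
  assumes L: "L > 0" and A\<^sub>c: "A\<^sub>c > 0" and T\<^sub>h: "T\<^sub>c \<le> T\<^sub>h"
    and C1\<kappa>: "Ck_on 1 {T\<^sub>c..} \<kappa>" and pos\<kappa>: "\<And>t. t \<ge> T\<^sub>c \<Longrightarrow> \<kappa> t > 0"
    and cont\<rho>: "continuous_on {T\<^sub>c..} \<rho>" and pos\<rho>: "\<And>t. t \<ge> T\<^sub>c \<Longrightarrow> \<rho> t > 0"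
    and diverges: "filterlim (\<lambda>b. integral {T\<^sub>c..b} (\<lambda>t. \<rho> t * \<kappa> t)) at_top at_top"
    and \<gamma>: "\<gamma> \<ge> 0"
begin

abbreviation solution :: "(real \<Rightarrow> real) \<Rightarrow> bool" where
  "solution \<equiv> thermo_solution L A\<^sub>c T\<^sub>h T\<^sub>c \<kappa> \<rho> \<alpha>\<^sub>0 \<gamma>"

abbreviation J :: "(real \<Rightarrow> real) \<Rightarrow> real" where
  "J \<equiv> thermo_J L A\<^sub>c T\<^sub>h T\<^sub>c \<rho> \<alpha>\<^sub>0 \<gamma>"

lemma cont\<kappa>: "continuous_on {T\<^sub>c..} \<kappa>"
  using C1\<kappa> by (auto intro: DERIV_continuous_on)

lemma solution_boundary:
  assumes "solution T"
  shows "T 0 = T\<^sub>h" and "T L = T\<^sub>c" and "x \<in> {0..L} \<Longrightarrow> T\<^sub>c \<le> T x"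
  using assms unfolding thermo_solution_def by blast+

text \<open>
  The second-order equation written for \<open>T\<close> and its flux \<open>w = \<kappa>(T) T\<^sub>x\<close>. For uniqueness it suffices
  to have the equations in the interior and continuity up to the ends.
\<close>

lemma solution_flux:
  assumes sol: "solution T"
  obtains w where "continuous_on {0..L} T" "continuous_on {0..L} w"
    "\<And>x. x \<in> {0<..<L} \<Longrightarrow> (T has_real_derivative w x / \<kappa> (T x)) (at x)"
    "\<And>x. x \<in> {0<..<L} \<Longrightarrow>
       (w has_real_derivative - (J T)\<^sup>2 * \<rho> (T x)) (at x)"
proof -
  obtain T' T'' where T': "\<And>x. x \<in> {0..L} \<Longrightarrow> (T has_real_derivative T' x) (at x within {0..L})"
    and T'': "\<And>x. x \<in> {0..L} \<Longrightarrow> (T' has_real_derivative T'' x) (at x within {0..L})"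
    using sol unfolding thermo_solution_def numeral_2_eq_2 Ck_on.simps by blast
  have contT: "continuous_on {0..L} T" and contT': "continuous_on {0..L} T'"
    using T' T'' by (blast intro: DERIV_continuous_on)+
  have range: "T x \<ge> T\<^sub>c" if "x \<in> {0..L}" for x
    using sol that unfolding thermo_solution_def by blast
  define w where "w x = \<kappa> (T x) * T' x" for x
  have contw: "continuous_on {0..L} w"
    unfolding w_def using contT contT' range
    by (auto intro!: continuous_intros continuous_on_compose2[OF cont\<kappa>])
  have dT: "(T has_real_derivative T' x) (at x)" if "x \<in> {0<..<L}" for x
    using T'[of x] that by (simp add: at_within_Icc_at)
  have "(w has_real_derivative - (J T)\<^sup>2 * \<rho> (T x)) (at x)"
    if x: "x \<in> {0<..<L}" for x
  proof -
    obtain q where q: "((\<lambda>y. \<kappa> (T y) * deriv T y) has_real_derivative q) (at x)"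
      "q + \<rho> (T x) * (J T)\<^sup>2 = 0"
      using sol x unfolding thermo_solution_def by blast
    have "(w has_real_derivative q) (at x)"
      by (rule has_field_derivative_transform_within_open[OF q(1), of "{0<..<L}"])
        (use x in \<open>auto simp: w_def dT[THEN DERIV_imp_deriv]\<close>)
    then show ?thesis
      using q(2) by (simp add: add_eq_0_iff mult.commute)
  qed
  moreover have "(T has_real_derivative w x / \<kappa> (T x)) (at x)" if "x \<in> {0<..<L}" for x
    using dT[OF that] pos\<kappa>[OF range, of x] that by (simp add: w_def)
  ultimately show thesis
    using that contT contw by blast
qed

text \<open>
  Conversely, differentiating \<open>T\<^sub>x = w / \<kappa>(T)\<close> once more gives \<open>T \<in> C\<^sup>2\<close>; this is where
  \<open>\<kappa> \<in> C\<^sup>1\<close> enters.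
\<close>

lemma solution_of_flux:
  assumes bc: "T 0 = T\<^sub>h" "T L = T\<^sub>c" and range: "\<And>x. x \<in> {0..L} \<Longrightarrow> T\<^sub>c \<le> T x"
    and dT: "\<And>x. x \<in> {0..L} \<Longrightarrow> (T has_real_derivative w x / \<kappa> (T x)) (at x)"
    and dw: "\<And>x. x \<in> {0..L} \<Longrightarrow>
       (w has_real_derivative - (J T)\<^sup>2 * \<rho> (T x)) (at x)"
  shows "solution T"
proof -
  define q where "q = - (J T)\<^sup>2"
  obtain \<kappa>' where d\<kappa>: "\<And>t. t \<ge> T\<^sub>c \<Longrightarrow> (\<kappa> has_real_derivative \<kappa>' t) (at t within {T\<^sub>c..})"
    and cont\<kappa>': "continuous_on {T\<^sub>c..} \<kappa>'"
    using C1\<kappa> by auto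
  define T' where "T' x = w x / \<kappa> (T x)" for x
  define T'' where
    "T'' x = (q * \<rho> (T x) * \<kappa> (T x) - w x * (\<kappa>' (T x) * T' x)) / (\<kappa> (T x) * \<kappa> (T x))" for x
  have contT: "continuous_on {0..L} T" and contw: "continuous_on {0..L} w"
    using dT dw by (meson DERIV_isCont continuous_at_imp_continuous_on)+
  have image: "T ` {0..L} \<subseteq> {T\<^sub>c..}"
    using range by auto
  note cont = contw continuous_on_compose2[OF cont\<kappa> contT image]
    continuous_on_compose2[OF cont\<kappa>' contT image] continuous_on_compose2[OF cont\<rho> contT image]
  have nz: "\<kappa> (T x) \<noteq> 0" if "x \<in> {0..L}" for x
    using pos\<kappa>[OF range[OF that]] by simp
  have contT': "continuous_on {0..L} T'"
    unfolding T'_def using cont nz by (intro continuous_intros) auto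
  have contT'': "continuous_on {0..L} T''"
    unfolding T''_def using cont contT' nz by (intro continuous_intros) auto
  have dT': "(T' has_real_derivative T'' x) (at x within {0..L})" if x: "x \<in> {0..L}" for x
  proof -
    have "(\<kappa> has_real_derivative \<kappa>' (T x)) (at (T x) within T ` {0..L})"
      using d\<kappa>[OF range[OF x]] image by (rule DERIV_subset)
    moreover have "(T has_real_derivative T' x) (at x within {0..L})"
      using dT[OF x] unfolding T'_def by (rule has_field_derivative_at_within)
    ultimately have "((\<lambda>x. \<kappa> (T x)) has_real_derivative \<kappa>' (T x) * T' x) (at x within {0..L})"
      using DERIV_image_chain[of \<kappa> _ T x "{0..L}"] by (simp add: o_def)
    moreover have "(w has_real_derivative q * \<rho> (T x)) (at x within {0..L})"
      using dw[OF x] unfolding q_def by (rule has_field_derivative_at_within)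
    ultimately show ?thesis
      unfolding T'_def[abs_def] T''_def using nz[OF x]
      by (auto intro!: derivative_eq_intros simp: T'_def)
  qed
  have "Ck_on 2 {0..L} T"
    unfolding numeral_2_eq_2 Ck_on.simps using dT dT' contT''
    by (metis T'_def has_field_derivative_at_within)
  moreover have "((\<lambda>y. \<kappa> (T y) * deriv T y) has_real_derivative q * \<rho> (T x)) (at x)"
    if x: "x \<in> {0<..<L}" for x
  proof -
    have "(w has_real_derivative q * \<rho> (T x)) (at x)"
      using dw x unfolding q_def by simp
    then show ?thesis
      by (rule has_field_derivative_transform_within_open[of w _ _ "{0<..<L}"])
        (use x in \<open>auto simp: dT[THEN DERIV_imp_deriv] nz\<close>)
  qed
  ultimately show ?thesis
    unfolding thermo_solution_def using bc range by (force simp: q_def)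
qed

section \<open>Well-posedness\<close>

text \<open>Constant extensions of the coefficients to the left of \<open>T\<^sub>c\<close>.\<close>

definition k :: "real \<Rightarrow> real" where
  "k t = \<kappa> (max T\<^sub>c t)"

definition r :: "real \<Rightarrow> real" where
  "r t = \<rho> (max T\<^sub>c t)"

lemma k_eq: "t \<ge> T\<^sub>c \<Longrightarrow> k t = \<kappa> t" and r_eq: "t \<ge> T\<^sub>c \<Longrightarrow> r t = \<rho> t"
  by (auto simp: k_def r_def)

lemma posk: "k t > 0" and posr: "r t > 0"
  by (auto simp: k_def r_def intro: pos\<kappa> pos\<rho>)

lemma contk: "continuous_on UNIV k"
  unfolding k_def by (rule continuous_on_compose2[OF cont\<kappa>]) (auto intro!: continuous_intros)

lemma contr: "continuous_on UNIV r"
  unfolding r_def by (rule continuous_on_compose2[OF cont\<rho>]) (auto intro!: continuous_intros)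

text \<open>The case of vanishing voltage, where \<open>J[T] = 0\<close> whatever \<open>T\<close> is.\<close>

lemma conduction_well_posed:
  assumes "thermo_V \<alpha>\<^sub>0 T\<^sub>h T\<^sub>c = 0"
  shows "\<exists>T. solution T" and "solution T\<^sub>1 \<Longrightarrow> solution T\<^sub>2 \<Longrightarrow> x \<in> {0..L} \<Longrightarrow> T\<^sub>1 x = T\<^sub>2 x"
proof -
  have J0: "J T = 0" for T
    using assms unfolding thermo_J_def by simp
  obtain T c where T: "T 0 = T\<^sub>h" "T L = T\<^sub>c" "\<And>x. x \<in> {0..L} \<Longrightarrow> T\<^sub>c \<le> T x"
    "\<And>x. x \<in> {0..L} \<Longrightarrow> (T has_real_derivative c / k (T x)) (at x)"
    using conduction_exists[OF contk posk L T\<^sub>h] by blast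
  have "solution T"
    by (rule solution_of_flux[of _ "\<lambda>_. c"])
      (use T in \<open>auto simp: J0 k_eq[symmetric]\<close>)
  then show "\<exists>T. solution T"
    by blast
  have "\<exists>c. conduction_solution k L T\<^sub>h T\<^sub>c T c" if sol: "solution T" for T
  proof -
    obtain w where contT: "continuous_on {0..L} T" and contw: "continuous_on {0..L} w"
      and dT: "\<And>x. x \<in> {0<..<L} \<Longrightarrow> (T has_real_derivative w x / \<kappa> (T x)) (at x)"
      and dw: "\<And>x. x \<in> {0<..<L} \<Longrightarrow> (w has_real_derivative 0) (at x)"
      using solution_flux[OF sol] by (auto simp: J0)
    have "w x = w 0" if "x \<in> {0<..<L}" for x
      using contw dw that by (intro DERIV_isconst2[OF L]) auto
    then have "(T has_real_derivative w 0 / k (T x)) (at x)" if "x \<in> {0<..<L}" for x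
      using dT[OF that] that solution_boundary(3)[OF sol] by (simp add: k_eq)
    then show ?thesis
      unfolding conduction_solution_def using contT solution_boundary(1,2)[OF sol] by blast
  qed
  then show "T\<^sub>1 x = T\<^sub>2 x" if "solution T\<^sub>1" "solution T\<^sub>2" "x \<in> {0..L}"
    using conduction_unique[OF contk posk L] that by blast
qed

definition M :: real where
  "M = \<bar>thermo_V \<alpha>\<^sub>0 T\<^sub>h T\<^sub>c\<bar> / (1 + \<gamma>)"

lemma abs_J: "\<bar>J T\<bar> = M / \<bar>integral {0..L} (\<lambda>x. \<rho> (T x))\<bar>"
  unfolding thermo_J_def thermo_R_def M_def using A\<^sub>c \<gamma> by (simp add: abs_mult)

text \<open>
  Integrating \<open>v\<^sub>x = - j \<rho>(T)\<close> shows \<open>\<integral>\<rho>(T) = M / j\<close>, which says that the parameter \<open>j\<close> of the system is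
  the nonlocal coefficient \<open>\<bar>J[T]\<bar>\<close>. Only \<open>J\<^sup>2\<close> enters the equation, so its sign is immaterial.
\<close>

lemma solution_of_coupled_system:
  assumes M: "M > 0" and j: "j > 0" and bc: "T 0 = T\<^sub>h" "T L = T\<^sub>c" "v 0 - v L = M"
    and range: "\<And>x. x \<in> {0..L} \<Longrightarrow> T\<^sub>c \<le> T x"
    and dT: "\<And>x. x \<in> {0..L} \<Longrightarrow> (T has_real_derivative j * v x / k (T x)) (at x)"
    and dv: "\<And>x. x \<in> {0..L} \<Longrightarrow> (v has_real_derivative - j * r (T x)) (at x)"
  shows "solution T"
proof -
  have dv\<rho>: "(v has_real_derivative - j * \<rho> (T x)) (at x)" if "x \<in> {0..L}" for x
    using dv[OF that] range[OF that] by (simp add: r_eq)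
  have "((\<lambda>x. - j * \<rho> (T x)) has_integral v L - v 0) {0..L}"
    using dv\<rho> L
    by (intro fundamental_theorem_of_calculus)
      (auto simp: has_real_derivative_iff_has_vector_derivative[symmetric]
         intro: has_field_derivative_at_within)
  then have "integral {0..L} (\<lambda>x. - j * \<rho> (T x)) = v L - v 0"
    by (rule integral_unique)
  then have "j * integral {0..L} (\<lambda>x. \<rho> (T x)) = M"
    using bc(3) by simp
  then have "integral {0..L} (\<lambda>x. \<rho> (T x)) = M / j"
    using j by (simp add: field_simps)
  then have "\<bar>J T\<bar> = j"
    using abs_J[of T] M j by simp
  then have J2: "(J T)\<^sup>2 = j\<^sup>2"
    by (metis power2_abs)
  show ?thesis
  proof (rule solution_of_flux[of T "\<lambda>x. j * v x", OF bc(1,2) range])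
    show "(T has_real_derivative j * v x / \<kappa> (T x)) (at x)" if "x \<in> {0..L}" for x
      using dT[OF that] range[OF that] by (simp add: k_eq)
    show "((\<lambda>x. j * v x) has_real_derivative - (J T)\<^sup>2 * \<rho> (T x)) (at x)"
      if "x \<in> {0..L}" for x
      using DERIV_cmult[OF dv\<rho>[OF that], of j] unfolding J2
      by (simp add: power2_eq_square mult.assoc)
  qed
qed

text \<open>
  A positive integral of \<open>\<rho>(T)\<close> makes \<open>j = \<bar>J[T]\<bar>\<close> positive, so that the flux can be divided by it.
\<close>

lemma solution_coupled_system:
  assumes M: "M > 0" and sol: "solution T"
  obtains v where "coupled_solution r k L T\<^sub>h T\<^sub>c M T v \<bar>J T\<bar>"
proof -
  define j where "j = \<bar>J T\<bar>"
  note range = solution_boundary(3)[OF sol]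
  obtain w where contT: "continuous_on {0..L} T" and contw: "continuous_on {0..L} w"
    and dT: "\<And>x. x \<in> {0<..<L} \<Longrightarrow> (T has_real_derivative w x / \<kappa> (T x)) (at x)"
    and dw: "\<And>x. x \<in> {0<..<L} \<Longrightarrow> (w has_real_derivative - j\<^sup>2 * \<rho> (T x)) (at x)"
    using solution_flux[OF sol] by (auto simp: j_def)
  define I where "I = integral {0..L} (\<lambda>x. \<rho> (T x))"
  have contI: "continuous_on {0..L} (\<lambda>x. \<rho> (T x))"
    using range contT by (intro continuous_on_compose2[OF cont\<rho>]) auto
  have posI: "\<rho> (T x) > 0" if "x \<in> {0..L}" for x
    using pos\<rho> range[OF that] by simp
  have "I \<noteq> 0"
    using integral_eq_0_iff[OF contI L] posI L unfolding I_def by (force simp: less_imp_le)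
  moreover have "I \<ge> 0"
    unfolding I_def using posI
    by (intro integral_nonneg integrable_continuous_interval contI) (auto intro: less_imp_le)
  ultimately have I: "I > 0"
    by simp
  have jI: "j = M / I"
    unfolding j_def abs_J using I by (simp add: I_def)
  then have j: "j > 0"
    using I M by simp
  define v where "v x = w x / j" for x
  have contv: "continuous_on {0..L} v"
    unfolding v_def using contw j by (intro continuous_intros) auto
  have dv: "(v has_real_derivative - j * \<rho> (T x)) (at x)" if "x \<in> {0<..<L}" for x
    using DERIV_cdivide[OF dw[OF that], of j] j unfolding v_def by (simp add: power2_eq_square)
  have "((\<lambda>x. - j * \<rho> (T x)) has_integral v L - v 0) {0..L}"
    using L contv dv
    by (intro fundamental_theorem_of_calculus_interior)
      (auto simp: has_real_derivative_iff_has_vector_derivative[symmetric])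
  then have "integral {0..L} (\<lambda>x. - j * \<rho> (T x)) = v L - v 0"
    by (rule integral_unique)
  then have "j * I = v 0 - v L"
    by (simp add: I_def)
  then have "v 0 - v L = M"
    using jI I by simp
  moreover have "(T has_real_derivative j * v x / k (T x)) (at x)"
    and "(v has_real_derivative - j * r (T x)) (at x)" if "x \<in> {0<..<L}" for x
    using dT[OF that] dv[OF that] range[of x] that j by (simp_all add: v_def k_eq r_eq)
  ultimately show thesis
    using that contT contv solution_boundary(1,2)[OF sol]
    unfolding coupled_solution_def j_def by blast
qed

text \<open>
  The case of nonzero voltage. The divergence of \<open>\<integral>\<rho> \<kappa>\<close> makes the antiderivative \<open>P\<close> onto, so that
  the whole orbit prescribed by the end values of \<open>v\<close> exists.
\<close>

lemma joule_heating_well_posed: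
  assumes "thermo_V \<alpha>\<^sub>0 T\<^sub>h T\<^sub>c \<noteq> 0"
  shows "\<exists>T. solution T" and "solution T\<^sub>1 \<Longrightarrow> solution T\<^sub>2 \<Longrightarrow> x \<in> {0..L} \<Longrightarrow> T\<^sub>1 x = T\<^sub>2 x"
proof -
  have M: "M > 0"
    unfolding M_def using assms \<gamma> by simp
  have "continuous_on UNIV (\<lambda>t. r t * k t)"
    using contr contk by (intro continuous_intros)
  then obtain P where P: "\<And>t. (P has_real_derivative r t * k t) (at t)"
    using antiderivative_exists by blast
  have "integral {T\<^sub>c..b} (\<lambda>t. r t * k t) = integral {T\<^sub>c..b} (\<lambda>t. \<rho> t * \<kappa> t)" for b
    by (rule integral_cong) (simp add: r_eq k_eq)
  then have surj: "surj P"
    using diverges posr posk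
    by (intro surj_antiderivative[OF P, of T\<^sub>c]) (auto simp: r_def k_def max_def)
  obtain T v j where "j > 0" "T 0 = T\<^sub>h" "T L = T\<^sub>c" "v 0 - v L = M"
    "\<And>x. x \<in> {0..L} \<Longrightarrow> T\<^sub>c \<le> T x"
    "\<And>x. x \<in> {0..L} \<Longrightarrow> (T has_real_derivative j * v x / k (T x)) (at x)"
    "\<And>x. x \<in> {0..L} \<Longrightarrow> (v has_real_derivative - j * r (T x)) (at x)"
    using coupled_system_exists[OF contr posr posk P surj L M T\<^sub>h] by blast
  with M have "solution T"
    by (intro solution_of_coupled_system)
  then show "\<exists>T. solution T"
    by blast
  show "T\<^sub>1 x = T\<^sub>2 x" if "solution T\<^sub>1" "solution T\<^sub>2" "x \<in> {0..L}"
    using coupled_system_unique[OF contr posr posk P surj L M]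
      solution_coupled_system[OF M] that by metis
qed

end

theorem theorem2p1:
  fixes L A\<^sub>c T\<^sub>h T\<^sub>c \<alpha>\<^sub>0 \<gamma> :: real and \<kappa> \<rho> :: "real \<Rightarrow> real"
  assumes "L > 0" and "A\<^sub>c > 0" and "T\<^sub>h \<ge> T\<^sub>c" and "T\<^sub>c > 0"
    and "Ck_on 1 {T\<^sub>c..} \<kappa>"
    and "\<forall>t\<in>{T\<^sub>c..}. \<kappa> t > 0"
    and "local_lipschitz (UNIV :: real set) {T\<^sub>c..} (\<lambda>_. \<rho>)"
    and "\<forall>t\<in>{T\<^sub>c..}. \<rho> t > 0"
    and "filterlim (\<lambda>b. integral {T\<^sub>c..b} (\<lambda>t. \<rho> t * \<kappa> t)) at_top at_top"
    and "\<gamma> \<ge> 0"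
  shows "(\<exists>T. thermo_solution L A\<^sub>c T\<^sub>h T\<^sub>c \<kappa> \<rho> \<alpha>\<^sub>0 \<gamma> T) \<and>
         (\<forall>T\<^sub>1 T\<^sub>2. thermo_solution L A\<^sub>c T\<^sub>h T\<^sub>c \<kappa> \<rho> \<alpha>\<^sub>0 \<gamma> T\<^sub>1 \<longrightarrow>
                  thermo_solution L A\<^sub>c T\<^sub>h T\<^sub>c \<kappa> \<rho> \<alpha>\<^sub>0 \<gamma> T\<^sub>2 \<longrightarrow>
                  (\<forall>x\<in>{0..L}. T\<^sub>1 x = T\<^sub>2 x))"
proof -
  interpret thermo_problem L A\<^sub>c T\<^sub>h T\<^sub>c \<alpha>\<^sub>0 \<gamma> \<kappa> \<rho>
    using assms local_lipschitz_continuous_on[OF assms(7), of 0] by unfold_locales auto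
  show ?thesis
    using conduction_well_posed joule_heating_well_posed
    by (cases "thermo_V \<alpha>\<^sub>0 T\<^sub>h T\<^sub>c = 0") blast+
qed

end
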